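(* There exists a monotonically shrinking temporal split graph $\mathcal{S}$ (that is, a monotonically shrinking temporal graph whose underlying static graph is a split graph) such that there is no Nash equilibrium in the two-player reverse temporal Voronoi game $\mathrm{rVor}(\mathcal{S},2)$.
   Context: A temporal graph $\mathcal{G}=(V,(E_t)_{t=1}^\infty)$ consists of a finite nonempty vertex set $V$ and an infinite sequence of edge sets $E_t\subseteq\binom{V}{2}$; it is assumed that the sequence is eventually constant (finite lifetime), i.e. there is $\tau$ with $E_t=E_\tau$ for all $t\ge\tau$. The underlying static graph is $(V,\bigcup_{t\ge1}E_t)$. A split graph is a static graph whose vertex set can be partitioned into a clique and an independent set; a temporal split graph is a temporal graph whose underlying graph is a split graph. $\mathcal{G}$ is monotonically shrinking if $E_{t+1}\subseteq E_t$ for all $t\ge 1$. A temporal walk from $u$ to $v$ is a sequence $(\{v_0=u,v_1\},t_1),(\{v_1,v_2\},t_2),\dots,(\{v_{d-1},v_d=v\},t_d)$ with $t_i<t_{i+1}$ for all $i\in\{1,\dots,d-1\}$ (strictly increasing times) and $\{v_{i-1},v_i\}\in E_{t_i}$ for all $i\in\{1,\dots,d\}$; its arrival time is $t_d$. The temporal distance $\mathrm{td}(u,v)$ is the minimum arrival time of a temporal walk from $u$ to $v$, with $\mathrm{td}(u,u)=0$ and $\mathrm{td}(u,v)=\infty$ if there is no such walk. In the two-player reverse temporal Voronoi game $\mathrm{rVor}(\mathcal{G},2)$, each player $i\in\{1,2\}$ selects one vertex $p_i\in V$ (equal choices are allowed). Player $i$ wins the set $U_i(p_1,p_2)=\{v\in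 V\mid \mathrm{td}(v,p_i)<\mathrm{td}(v,p_j)\}$, where $j\ne i$ is the other player, and her payoff is $u_i(p_1,p_2)=|U_i(p_1,p_2)|$. A profile $(p_1,p_2)\in V^2$ is a Nash equilibrium if $u_1(p',p_2)\le u_1(p_1,p_2)$ and $u_2(p_1,p')\le u_2(p_1,p_2)$ for all $p'\in V$. *)

theory Defs
  imports Main "HOL-Library.Extended_Nat"
begin

text \<open>
  A temporal graph is given by a vertex set \<open>V\<close> and a sequence \<open>E\<close> of edge sets, an edge being a
  two-element set of vertices. Time steps start at 1; the value \<open>E 0\<close> is never used.
\<close>

definition temporal_graph :: "'a set \<Rightarrow> (nat \<Rightarrow> 'a set set) \<Rightarrow> bool" where
  "temporal_graph V E \<longleftrightarrow>
     finite V \<and> V \<noteq> {} \<and>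
     (\<forall>t\<ge>1. E t \<subseteq> {e. e \<subseteq> V \<and> card e = 2}) \<and>
     (\<exists>\<tau>\<ge>1. \<forall>t\<ge>\<tau>. E t = E \<tau>)"

definition underlying_edges :: "(nat \<Rightarrow> 'a set set) \<Rightarrow> 'a set set" where
  "underlying_edges E = (\<Union>t\<in>{1..}. E t)"

text \<open>Either part of the partition may be empty.\<close>

definition split_graph :: "'a set \<Rightarrow> 'a set set \<Rightarrow> bool" where
  "split_graph V F \<longleftrightarrow>
     (\<exists>C I. C \<union> I = V \<and> C \<inter> I = {} \<and>
        (\<forall>x\<in>C. \<forall>y\<in>C. x \<noteq> y \<longrightarrow> {x, y} \<in> F) \<and>
        (\<forall>x\<in>I. \<forall>y\<in>I. {x, y} \<notin> F))"

definition temporal_split_graph :: "'a set \<Rightarrow> (nat \<Rightarrow> 'a set set) \<Rightarrow> bool" where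
  "temporal_split_graph V E \<longleftrightarrow> temporal_graph V E \<and> split_graph V (underlying_edges E)"

definition monotonically_shrinking :: "(nat \<Rightarrow> 'a set set) \<Rightarrow> bool" where
  "monotonically_shrinking E \<longleftrightarrow> (\<forall>t\<ge>1. E (Suc t) \<subseteq> E t)"

text \<open>
  A temporal walk is a nonempty list of pairs of an edge and a time; \<open>vs\<close> is the sequence
  of vertices it visits.
\<close>

definition temporal_walk ::
    "(nat \<Rightarrow> 'a set set) \<Rightarrow> 'a \<Rightarrow> 'a \<Rightarrow> ('a set \<times> nat) list \<Rightarrow> bool" where
  "temporal_walk E u v w \<longleftrightarrow>
     w \<noteq> [] \<and> sorted_wrt (<) (map snd w) \<and>
     (\<exists>vs. length vs = Suc (length w) \<and> hd vs = u \<and> last vs = v \<and>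
        (\<forall>i<length w. fst (w ! i) = {vs ! i, vs ! Suc i} \<and>
           1 \<le> snd (w ! i) \<and> fst (w ! i) \<in> E (snd (w ! i))))"

definition arrival_time :: "('a set \<times> nat) list \<Rightarrow> nat" where
  "arrival_time w = snd (last w)"

text \<open>
  The infimum of a nonempty set of extended naturals is its minimum, and that of the empty set
  is \<open>\<infinity>\<close>.
\<close>

definition temporal_distance :: "(nat \<Rightarrow> 'a set set) \<Rightarrow> 'a \<Rightarrow> 'a \<Rightarrow> enat" where
  "temporal_distance E u v =
     (if u = v then 0 else (INF w\<in>{w. temporal_walk E u v w}. enat (arrival_time w)))"

text \<open>
  The game is symmetric, so one function serves both players: \<open>rvor_won V E p q\<close> is the set
  won by the player at \<open>p\<close> against an opponent at \<open>q\<close>. In the profile \<open>(p\<^sub>1, p\<^sub>2)\<close>, player 1 wins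
  \<open>rvor_won V E p\<^sub>1 p\<^sub>2\<close> and player 2 wins \<open>rvor_won V E p\<^sub>2 p\<^sub>1\<close>. Distances run from the vertices
  to the players.
\<close>

definition rvor_won :: "'a set \<Rightarrow> (nat \<Rightarrow> 'a set set) \<Rightarrow> 'a \<Rightarrow> 'a \<Rightarrow> 'a set" where
  "rvor_won V E p q = {v \<in> V. temporal_distance E v p < temporal_distance E v q}"

definition rvor_payoff :: "'a set \<Rightarrow> (nat \<Rightarrow> 'a set set) \<Rightarrow> 'a \<Rightarrow> 'a \<Rightarrow> nat" where
  "rvor_payoff V E p q = card (rvor_won V E p q)"

definition rvor_nash_equilibrium :: "'a set \<Rightarrow> (nat \<Rightarrow> 'a set set) \<Rightarrow> 'a \<times> 'a \<Rightarrow> bool" where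
  "rvor_nash_equilibrium V E = (\<lambda>(p\<^sub>1, p\<^sub>2).
     p\<^sub>1 \<in> V \<and> p\<^sub>2 \<in> V \<and>
     (\<forall>p'\<in>V. rvor_payoff V E p' p\<^sub>2 \<le> rvor_payoff V E p\<^sub>1 p\<^sub>2) \<and>
     (\<forall>p'\<in>V. rvor_payoff V E p' p\<^sub>1 \<le> rvor_payoff V E p\<^sub>2 p\<^sub>1))"

end

theory Submission
  imports Defs
begin

text \<open>
  The witness has eight vertices, the clique \<open>{0, 1, 2, 3}\<close> and the independent set \<open>{4, 5, 6, 7}\<close>.
  At time 1 all clique edges are present, together with \<open>{0, 6}\<close>, \<open>{1, 6}\<close>, \<open>{0, 7}\<close>, \<open>{1, 5}\<close>,
  \<open>{2, 4}\<close>, \<open>{3, 4}\<close>; at time 2 only \<open>{0, 2}\<close>, \<open>{1, 3}\<close>, \<open>{0, 6}\<close>, \<open>{1, 6}\<close>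
  remain; at time 3 only \<open>{0, 6}\<close>, \<open>{1, 6}\<close>; afterwards nothing. The best responses to
  clique vertices are unique and run in the cycle \<open>0 \<rightarrow> 3 \<rightarrow> 1 \<rightarrow> 2 \<rightarrow> 0\<close>. Those to the other
  vertices lie in the clique, except that 6 is also a best response to 4. So no two vertices, equal
  or not, are best responses to each other. The graph was found by computer search.
\<close>

section \<open>Temporal distance by layers\<close>

text \<open>Strictly increasing times allow at most one edge per time step, so each layer grows by
  single edges from the layer before. Keeping the old layer allows waiting.\<close>

primrec reach :: "(nat \<Rightarrow> 'a set set) \<Rightarrow> 'a \<Rightarrow> nat \<Rightarrow> 'a set" where
  "reach E u 0 = {u}"
| "reach E u (Suc t) = reach E u t \<union> {v. \<exists>x\<in>reach E u t. {x, v} \<in> E (Suc t)}"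

lemma start_in_reach: "u \<in> reach E u t"
  by (induction t) auto

lemma reach_mono:
  assumes "s \<le> t" and "v \<in> reach E u s"
  shows "v \<in> reach E u t"
  using assms by (induction rule: dec_induct) auto

lemma temporal_walkI:
  assumes "w \<noteq> []" and "sorted_wrt (<) (map snd w)"
    and "length vs = Suc (length w)" and "hd vs = u" and "last vs = v"
    and "\<And>i. i < length w \<Longrightarrow> fst (w ! i) = {vs ! i, vs ! Suc i} \<and>
           1 \<le> snd (w ! i) \<and> fst (w ! i) \<in> E (snd (w ! i))"
  shows "temporal_walk E u v w"
  unfolding temporal_walk_def using assms by blast

text \<open>Peeling off the last edge matches the layers, which grow at the end of a walk. The case
  \<open>w = []\<close> is separate because a temporal walk has at least one edge.\<close>

lemma temporal_walk_snocD:
  assumes "temporal_walk E u v (w @ [(e, s)])"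
  shows "\<exists>x. e = {x, v} \<and> 1 \<le> s \<and> e \<in> E s \<and>
           (w = [] \<and> x = u \<or> temporal_walk E u x w \<and> arrival_time w < s)"
proof -
  from assms obtain vs where sorted: "sorted_wrt (<) (map snd (w @ [(e, s)]))"
    and len: "length vs = Suc (Suc (length w))" and hd: "hd vs = u" and last: "last vs = v"
    and steps: "\<And>i. i < Suc (length w) \<Longrightarrow>
          fst ((w @ [(e, s)]) ! i) = {vs ! i, vs ! Suc i} \<and>
          1 \<le> snd ((w @ [(e, s)]) ! i) \<and> fst ((w @ [(e, s)]) ! i) \<in> E (snd ((w @ [(e, s)]) ! i))"
    unfolding temporal_walk_def by auto
  let ?x = "vs ! length w"
  have v: "vs ! Suc (length w) = v"
    using len last by (metis diff_Suc_1 last_conv_nth length_0_conv nat.distinct(1))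
  have e: "e = {?x, v}" "1 \<le> s" "e \<in> E s"
    using steps[of "length w"] v by auto
  have "w = [] \<and> ?x = u \<or> temporal_walk E u ?x w \<and> arrival_time w < s"
  proof (cases "w = []")
    case True
    with hd len show ?thesis by (cases vs) auto
  next
    case False
    let ?vs = "butlast vs"
    have vs_nth: "?vs ! i = vs ! i" if "i \<le> length w" for i
      using that len by (simp add: nth_butlast)
    have "length ?vs = Suc (length w)" using len by simp
    moreover have "hd ?vs = u" using hd len by (cases vs) auto
    moreover have "last ?vs = ?x"
      using vs_nth[of "length w"] len
      by (metis calculation(1) diff_Suc_1 last_conv_nth length_0_conv nat.distinct(1) order_refl)
    moreover have "fst (w ! i) = {?vs ! i, ?vs ! Suc i} \<and> 1 \<le> snd (w ! i) \<and>
        fst (w ! i) \<in> E (snd (w ! i))" if "i < length w" for i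
      using steps[of i] that vs_nth[of i] vs_nth[of "Suc i"] by (auto simp: nth_append)
    moreover have "sorted_wrt (<) (map snd w)"
      using sorted by (simp add: sorted_wrt_append)
    ultimately have "temporal_walk E u ?x w"
      using False temporal_walkI[of w ?vs u ?x E] by blast
    moreover have "arrival_time w < s"
      using sorted False unfolding arrival_time_def by (simp add: sorted_wrt_append)
    ultimately show ?thesis by blast
  qed
  with e show ?thesis by blast
qed

lemma temporal_walk_single:
  assumes "{u, v} \<in> E s" and "1 \<le> s"
  shows "temporal_walk E u v [({u, v}, s)]"
  unfolding temporal_walk_def using assms by (intro conjI exI[of _ "[u, v]"]) auto

lemma temporal_walk_snocI:
  assumes "temporal_walk E u x w" and "arrival_time w < s" and "{x, v} \<in> E s"
  shows "temporal_walk E u v (w @ [({x, v}, s)])"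
proof -
  from assms(1) obtain vs where ne: "w \<noteq> []" and sorted: "sorted_wrt (<) (map snd w)"
    and len: "length vs = Suc (length w)" and hd: "hd vs = u" and last: "last vs = x"
    and steps: "\<And>i. i < length w \<Longrightarrow> fst (w ! i) = {vs ! i, vs ! Suc i} \<and>
          1 \<le> snd (w ! i) \<and> fst (w ! i) \<in> E (snd (w ! i))"
    unfolding temporal_walk_def by auto
  obtain w' a where w: "w = w' @ [a]" using ne by (cases w rule: rev_cases) auto
  have sorted': "sorted_wrt (<) (map snd (w @ [({x, v}, s)]))"
    using sorted assms(2) unfolding w arrival_time_def
    by (auto simp: sorted_wrt_append intro: less_trans)
  have x: "vs ! length w = x"
    using len last by (metis diff_Suc_1 last_conv_nth length_0_conv nat.distinct(1))
  let ?w = "w @ [({x, v}, s)]" and ?vs = "vs @ [v]"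
  have "fst (?w ! i) = {?vs ! i, ?vs ! Suc i} \<and> 1 \<le> snd (?w ! i) \<and> fst (?w ! i) \<in> E (snd (?w ! i))"
    if "i < length ?w" for i
  proof (cases "i < length w")
    case True
    with steps[of i] len show ?thesis by (auto simp: nth_append)
  next
    case False
    with that have "i = length w" by simp
    \<comment> \<open>The bound \<open>1 \<le> s\<close> comes from
      \<open>arrival_time w < s\<close>.\<close>
    with len x assms(2,3) show ?thesis by (simp add: nth_append)
  qed
  moreover have "hd ?vs = u" "last ?vs = v" "length ?vs = Suc (length ?w)" "?w \<noteq> []"
    using hd len by (cases vs; simp)+
  ultimately show ?thesis
    using sorted' temporal_walkI[of ?w ?vs u v E] by blast
qed

text \<open>If the last edge has time \<open>Suc r\<close>, strictness makes the earlier part arrive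
  by time \<open>r\<close>, so the last edge starts in layer \<open>r\<close>.\<close>

lemma temporal_walk_in_reach:
  assumes "temporal_walk E u v w" and "arrival_time w \<le> t"
  shows "v \<in> reach E u t"
  using assms
proof (induction w arbitrary: v t rule: rev_induct)
  case Nil
  then show ?case by (simp add: temporal_walk_def)
next
  case (snoc a w)
  obtain e s where a: "a = (e, s)" by fastforce
  from temporal_walk_snocD[OF snoc.prems(1)[unfolded a]]
  obtain x where x: "e = {x, v}" "1 \<le> s" "e \<in> E s"
    "w = [] \<and> x = u \<or> temporal_walk E u x w \<and> arrival_time w < s"
    by blast
  obtain r where r: "s = Suc r" using x(2) by (cases s) auto
  have "x \<in> reach E u r"
    using x(4) snoc.IH[of x r] start_in_reach[of u E r] r by auto
  then have "v \<in> reach E u s" using x(1,3) r by auto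
  moreover have "s \<le> t" using snoc.prems(2) a by (simp add: arrival_time_def)
  ultimately show ?case using reach_mono by fast
qed

lemma reach_temporal_walk:
  assumes "v \<in> reach E u t"
  shows "v = u \<or> (\<exists>w. temporal_walk E u v w \<and> arrival_time w \<le> t)"
  using assms
proof (induction t arbitrary: v)
  case 0
  then show ?case by simp
next
  case (Suc t)
  show ?case
  proof (cases "v \<in> reach E u t")
    case True
    then show ?thesis using Suc.IH le_SucI by blast
  next
    case False
    with Suc.prems obtain x where x: "x \<in> reach E u t" "{x, v} \<in> E (Suc t)" by auto
    from Suc.IH[OF x(1)] show ?thesis
    proof
      \<comment> \<open>There is no shorter walk to extend here, since walks are nonempty; the edge
        itself is the walk.\<close>
      assume "x = u"
      then have "temporal_walk E u v [({u, v}, Suc t)]"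
        using x(2) temporal_walk_single[of u v E "Suc t"] by simp
      then show ?thesis by (intro disjI2 exI[of _ "[({u, v}, Suc t)]"]) (simp add: arrival_time_def)
    next
      assume "\<exists>w. temporal_walk E u x w \<and> arrival_time w \<le> t"
      then obtain w where "temporal_walk E u x w" "arrival_time w < Suc t" by auto
      then have "temporal_walk E u v (w @ [({x, v}, Suc t)])"
        using x(2) by (rule temporal_walk_snocI)
      then show ?thesis
        by (intro disjI2 exI[of _ "w @ [({x, v}, Suc t)]"]) (simp add: arrival_time_def)
    qed
  qed
qed

lemma temporal_distance_le_iff: "temporal_distance E u v \<le> enat t \<longleftrightarrow> v \<in> reach E u t"
proof (cases "u = v")
  case True
  then show ?thesis by (simp add: temporal_distance_def start_in_reach)
next
  case False
  \<comment> \<open>An infimum strictly below a bound has an element below it, so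
    \<open>\<le>\<close> is turned into \<open><\<close> to extract a walk.\<close>
  have less_Suc: "a \<le> enat t \<longleftrightarrow> a < enat (Suc t)" for a
    by (cases a) auto
  have "temporal_distance E u v \<le> enat t \<longleftrightarrow> (\<exists>w. temporal_walk E u v w \<and> arrival_time w \<le> t)"
    using False unfolding less_Suc by (auto simp: temporal_distance_def INF_less_iff less_Suc_eq_le)
  then show ?thesis
    using False temporal_walk_in_reach[of E u v _ t] reach_temporal_walk[of v E u t] by auto
qed

text \<open>Finite upper bounds determine an element of \<open>enat\<close>, and \<infinity> is the
  one without any. Layers describe exactly these bounds for a distance.\<close>

lemma enat_eqI:
  assumes "\<And>t. a \<le> enat t \<longleftrightarrow> b \<le> enat t"
  shows "a = b"
proof (rule antisym)
  show "a \<le> b" using assms by (cases b) auto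
  show "b \<le> a" using assms by (cases a) auto
qed

section \<open>The witness\<close>

text \<open>Entry \<open>(i, j)\<close> is the last time at which \<open>{i, j}\<close> is an edge, and 0 if it never is.\<close>

definition deadline :: "nat \<Rightarrow> nat \<Rightarrow> nat" where
  "deadline i j =
    [[0, 1, 2, 1, 0, 0, 3, 1],
     [1, 0, 1, 2, 0, 1, 3, 0],
     [2, 1, 0, 1, 1, 0, 0, 0],
     [1, 2, 1, 0, 1, 0, 0, 0],
     [0, 0, 1, 1, 0, 0, 0, 0],
     [0, 1, 0, 0, 0, 0, 0, 0],
     [3, 3, 0, 0, 0, 0, 0, 0],
     [1, 0, 0, 0, 0, 0, 0, 0]] ! i ! j"

text \<open>Letting each pair live until a deadline makes the sequence shrinking by
  construction.\<close>

definition edges :: "nat \<Rightarrow> nat set set" where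
  "edges t = {{i, j} |i j. i < 8 \<and> j < 8 \<and> i \<noteq> j \<and> t \<le> deadline i j}"

text \<open>Entry \<open>(u, v)\<close> is the temporal distance from \<open>u\<close> to \<open>v\<close>, with 4 standing for \<open>\<infinity>\<close>.\<close>

definition distance :: "nat \<Rightarrow> nat \<Rightarrow> nat" where
  "distance u v =
    [[0, 1, 1, 1, 4, 4, 1, 1],
     [1, 0, 1, 1, 4, 1, 1, 4],
     [1, 1, 0, 1, 1, 4, 2, 4],
     [1, 1, 1, 0, 1, 4, 2, 4],
     [2, 2, 1, 1, 0, 4, 3, 4],
     [3, 1, 4, 2, 4, 0, 2, 4],
     [1, 1, 2, 2, 4, 4, 0, 4],
     [1, 3, 2, 4, 4, 4, 2, 0]] ! u ! v"

definition payoff :: "nat \<Rightarrow> nat \<Rightarrow> nat" where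
  "payoff p q = length (filter (\<lambda>v. distance v p < distance v q) [0..<8])"

text \<open>Best responses need not be unique: against 4, all clique vertices and 6 attain payoff 5,
  and the list picks 0.\<close>

definition best_response :: "nat \<Rightarrow> nat" where
  "best_response q = [3, 2, 0, 1, 0, 1, 0, 0] ! q"

text \<open>\<open>code_simp\<close> decides quantifiers over explicit lists; this turns the results
  into statements about bounded numbers.\<close>

lemma ball_upt: "(\<forall>x\<in>set [m..<n]. P x) \<longleftrightarrow> (\<forall>x. m \<le> x \<longrightarrow> x < n \<longrightarrow> P x)"
  by auto

lemma deadline_sym: "i < 8 \<Longrightarrow> j < 8 \<Longrightarrow> deadline i j = deadline j i"
proof -
  have "\<forall>i\<in>set [0..<8]. \<forall>j\<in>set [0..<8]. deadline i j = deadline j i" by code_simp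
  then show "i < 8 \<Longrightarrow> j < 8 \<Longrightarrow> deadline i j = deadline j i" unfolding ball_upt by blast
qed

lemma deadline_le: "i < 8 \<Longrightarrow> j < 8 \<Longrightarrow> deadline i j \<le> 3"
proof -
  have "\<forall>i\<in>set [0..<8]. \<forall>j\<in>set [0..<8]. deadline i j \<le> 3" by code_simp
  then show "i < 8 \<Longrightarrow> j < 8 \<Longrightarrow> deadline i j \<le> 3" unfolding ball_upt by blast
qed

text \<open>An unordered pair may be listed in either order, so the symmetry of the table is what
  lets its deadline be read off.\<close>

lemma mem_edges_iff: "{i, j} \<in> edges t \<longleftrightarrow> i < 8 \<and> j < 8 \<and> i \<noteq> j \<and> t \<le> deadline i j"
  using deadline_sym unfolding edges_def by (auto simp: doubleton_eq_iff)

lemma edges_empty: "4 \<le> t \<Longrightarrow> edges t = {}"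
  using deadline_le unfolding edges_def by fastforce

section \<open>The witness is a shrinking temporal split graph\<close>

lemma split_graph_edges: "split_graph {..<8} (underlying_edges edges)"
proof -
  have clique: "\<forall>i\<in>set [0..<4]. \<forall>j\<in>set [0..<4]. i \<noteq> j \<longrightarrow> 1 \<le> deadline i j" by code_simp
  have indep: "\<forall>i\<in>set [4..<8]. \<forall>j\<in>set [4..<8]. deadline i j = 0" by code_simp
  have mem: "{i, j} \<in> underlying_edges edges \<longleftrightarrow> i < 8 \<and> j < 8 \<and> i \<noteq> j \<and> 1 \<le> deadline i j" for i j
  proof
    assume "{i, j} \<in> underlying_edges edges"
    then obtain t where "1 \<le> t" "{i, j} \<in> edges t" unfolding underlying_edges_def by auto
    then show "i < 8 \<and> j < 8 \<and> i \<noteq> j \<and> 1 \<le> deadline i j" by (simp add: mem_edges_iff)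
  next
    assume "i < 8 \<and> j < 8 \<and> i \<noteq> j \<and> 1 \<le> deadline i j"
    then have "{i, j} \<in> edges 1" by (simp add: mem_edges_iff)
    then show "{i, j} \<in> underlying_edges edges" unfolding underlying_edges_def by auto
  qed
  show ?thesis
    unfolding split_graph_def
  proof (rule exI[of _ "{..<4}"], rule exI[of _ "{4..<8}"], intro conjI)
    show "\<forall>x\<in>{..<4}. \<forall>y\<in>{..<4}. x \<noteq> y \<longrightarrow> {x, y} \<in> underlying_edges edges"
      using clique by (auto simp: mem)
    show "\<forall>x\<in>{4..<8}. \<forall>y\<in>{4..<8}. {x, y} \<notin> underlying_edges edges"
      using indep unfolding ball_upt mem by auto
  qed auto
qed

lemma temporal_split_graph_edges: "temporal_split_graph {..<8} edges"
proof -
  have "edges t \<subseteq> {e. e \<subseteq> {..<8} \<and> card e = 2}" for t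
    unfolding edges_def by auto
  moreover have "\<exists>\<tau>\<ge>1. \<forall>t\<ge>\<tau>. edges t = edges \<tau>"
    by (rule exI[of _ 4]) (simp add: edges_empty)
  ultimately have "temporal_graph {..<8} edges"
    unfolding temporal_graph_def by (auto simp only: finite_lessThan lessThan_empty_iff)
  then show ?thesis
    using split_graph_edges by (simp add: temporal_split_graph_def)
qed

lemma monotonically_shrinking_edges: "monotonically_shrinking edges"
  unfolding monotonically_shrinking_def edges_def by (auto dest: Suc_leD)

section \<open>Correctness of the distance table\<close>

lemma distance_eq_0_iff:
  assumes "u < 8" and "v < 8"
  shows "distance u v = 0 \<longleftrightarrow> u = v"
proof -
  have "\<forall>u\<in>set [0..<8]. \<forall>v\<in>set [0..<8]. distance u v = 0 \<longleftrightarrow> u = v" by code_simp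
  then show ?thesis using assms by simp
qed

lemma distance_le: "u < 8 \<Longrightarrow> v < 8 \<Longrightarrow> distance u v \<le> 4"
proof -
  have "\<forall>u\<in>set [0..<8]. \<forall>v\<in>set [0..<8]. distance u v \<le> 4" by code_simp
  then show "u < 8 \<Longrightarrow> v < 8 \<Longrightarrow> distance u v \<le> 4" unfolding ball_upt by blast
qed

text \<open>The table obeys the recursion of \<open>reach\<close>. At \<open>t = 3\<close> this
  would fail, since the code 4 for \<infinity> would count as reached at time 4.\<close>

lemma distance_le_Suc_iff:
  assumes "u < 8" and "v < 8" and "t < 3"
  shows "distance u v \<le> Suc t \<longleftrightarrow>
    distance u v \<le> t \<or> (\<exists>x<8. distance u x \<le> t \<and> x \<noteq> v \<and> Suc t \<le> deadline x v)"
proof -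
  have "\<forall>t\<in>set [0..<3]. \<forall>u\<in>set [0..<8]. \<forall>v\<in>set [0..<8]. distance u v \<le> Suc t \<longleftrightarrow>
      distance u v \<le> t \<or>
      (\<exists>x\<in>set [0..<8]. distance u x \<le> t \<and> x \<noteq> v \<and> Suc t \<le> deadline x v)"
    by code_simp
  then show ?thesis using assms by (auto simp: atLeast0LessThan)
qed

lemma reach_edges:
  assumes "u < 8" and "t \<le> 3"
  shows "reach edges u t = {v. v < 8 \<and> distance u v \<le> t}"
  using assms(2)
proof (induction t)
  case 0
  then show ?case using assms(1) by (auto simp: distance_eq_0_iff)
next
  case (Suc t)
  then have IH: "reach edges u t = {v. v < 8 \<and> distance u v \<le> t}" and t: "t < 3" by auto
  have "v \<in> reach edges u (Suc t) \<longleftrightarrow> v < 8 \<and> distance u v \<le> Suc t" for v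
    unfolding reach.simps IH using distance_le_Suc_iff[OF assms(1) _ t, of v]
    by (auto simp: mem_edges_iff)
  then show ?case by blast
qed

text \<open>No edge survives time 3, so the layers stay constant from there on.\<close>

lemma reach_edges_after:
  assumes "3 \<le> t"
  shows "reach edges u t = reach edges u 3"
  using assms by (induction rule: dec_induct) (auto simp: edges_empty)

lemma temporal_distance_edges:
  assumes "u < 8" and "v < 8"
  shows "temporal_distance edges u v = (if distance u v = 4 then \<infinity> else enat (distance u v))"
    (is "?l = ?r")
proof -
  have "?l \<le> enat t \<longleftrightarrow> ?r \<le> enat t" for t
  proof (cases "t \<le> 3")
    case True
    then show ?thesis using assms by (auto simp: temporal_distance_le_iff reach_edges)
  next
    case False
    \<comment> \<open>After time 3, being reached means an entry of at most 3, which by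
      \<open>distance_le\<close> is the same as an entry other than 4.\<close>
    then show ?thesis
      using assms distance_le[OF assms]
      by (auto simp: temporal_distance_le_iff reach_edges reach_edges_after)
  qed
  then show ?thesis by (rule enat_eqI)
qed

section \<open>Payoffs and improving deviations\<close>

lemma rvor_payoff_edges:
  assumes "p < 8" and "q < 8"
  shows "rvor_payoff {..<8} edges p q = payoff p q"
proof -
  \<comment> \<open>Coding \<infinity> as 4 preserves strict comparisons because all finite entries
    are at most 3.\<close>
  have "temporal_distance edges v p < temporal_distance edges v q \<longleftrightarrow> distance v p < distance v q"
    if "v < 8" for v
    using that assms distance_le[of v p] distance_le[of v q] by (auto simp: temporal_distance_edges)
  then have "rvor_won {..<8} edges p q = set (filter (\<lambda>v. distance v p < distance v q) [0..<8])"
    unfolding rvor_won_def by auto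
  then show ?thesis
    unfolding rvor_payoff_def payoff_def by (simp only: distinct_card[OF distinct_filter[OF distinct_upt]])
qed

text \<open>Naming one deviation per opponent position reduces the absence of equilibria to a check
  of 64 profiles, including those with \<open>p = q\<close>.\<close>

lemma best_response_improves:
  assumes "p < 8" and "q < 8"
  shows "payoff p q < payoff (best_response q) q \<or> payoff q p < payoff (best_response p) p"
proof -
  have "\<forall>p\<in>set [0..<8]. \<forall>q\<in>set [0..<8].
      payoff p q < payoff (best_response q) q \<or> payoff q p < payoff (best_response p) p"
    by code_simp
  then show ?thesis using assms unfolding ball_upt by blast
qed

lemma best_response_less: "q < 8 \<Longrightarrow> best_response q < 8"
proof -
  have "\<forall>q\<in>set [0..<8]. best_response q < 8" by code_simp
  then show "q < 8 \<Longrightarrow> best_response q < 8" unfolding ball_upt by blast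
qed

theorem theorem8:
  shows "\<exists>(V :: nat set) (E :: nat \<Rightarrow> nat set set).
           temporal_split_graph V E \<and> monotonically_shrinking E \<and>
           \<not> (\<exists>p. rvor_nash_equilibrium V E p)"
proof (intro exI[of _ "{..<8}"] exI[of _ edges] conjI notI)
  assume "\<exists>p. rvor_nash_equilibrium {..<8} edges p"
  then obtain p q where pq: "p < 8" "q < 8"
    and p: "\<forall>r<8. rvor_payoff {..<8} edges r q \<le> rvor_payoff {..<8} edges p q"
    and q: "\<forall>r<8. rvor_payoff {..<8} edges r p \<le> rvor_payoff {..<8} edges q p"
    unfolding rvor_nash_equilibrium_def by auto
  have "payoff (best_response q) q \<le> payoff p q" "payoff (best_response p) p \<le> payoff q p"
    using p q pq best_response_less by (metis rvor_payoff_edges)+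
  with best_response_improves[OF pq] show False by linarith
qed (fact temporal_split_graph_edges monotonically_shrinking_edges)+

end
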